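(* Let $a,b\ge0$, let $f\in C^1(\mathbb R)$ be Lipschitz, let $\mathcal G_h,\mathcal L_h\in\mathbb R^{N_x^2\times N_x^2}$ be self-adjoint, non-negative definite and commuting, and let $J_f=cI$ with $c\ge0$. Let $h_t>0$ and $T=N_th_t$ with $N_t\in\mathbb N_+$. Suppose that one of the following holds. (i) (Allen–Cahn type) $\mathcal G_h=I$, and $b\,\mathrm{Lip}(R)\,T<1$; set $\widetilde\theta=b\,\mathrm{Lip}(R)\,T$. (ii) (Cahn–Hilliard type) $\mathcal G_h=\mathcal L_h$, and $b\,\mathrm{Lip}(R)\,T<2\sqrt{ah_t}+bch_t$; set $\widetilde\theta=\dfrac{b\,\mathrm{Lip}(R)\,T}{2\sqrt{ah_t}+bch_t}$. So $\widetilde\theta<1$ in both cases. With $\widehat F$ as in the context, let $\underline\sigma=\inf_U\sigma_{\min}(D\widehat F(U))$, $\overline\sigma=\sup_U\sigma_{\max}(D\widehat F(U))$, $\kappa=\overline\sigma/\underline\sigma$, $\epsilon=\kappa-\frac12$, $\gamma=\frac1\kappa-\frac1{2\kappa^2}$. Then every solution $(U_t,Q_t)_{t\ge0}$, with initial position $(U_0,Q_0)$, of the PDHG flow $$\dot Q=-\epsilon Q+\widehat F(U),\qquad\dot U=-D\widehat F(U)^\top\big((1-\gamma\epsilon)Q+\gamma\widehat F(U)\big)$$ satisfies, for all $t\ge0$, $$\|\widehat F(U_t)\|\le\exp\Big(-\frac5{32}\cdot\frac{(1-\widetilde\theta)^3}{1+\widetilde\theta}\,t\Big)\sqrt{\|\widehat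 F(U_0)\|^2+(1+\widetilde\theta)\|Q_0\|^2}.$$
   Context: Let $n=N_x^2$. Define $F:\mathbb R^{N_tn}\to\mathbb R^{N_tn}$ by $$F(U)=\mathscr DU+h_t\mathscr G_h(a\mathscr L_hU+bf(U))-V,$$ where $f$ acts entrywise, $\mathscr D=D_{N_t}\otimes I_n$ with $D_{N_t}$ the $N_t\times N_t$ matrix having $1$ on the diagonal, $-1$ on the first subdiagonal and $0$ elsewhere, $\mathscr G_h=I_{N_t}\otimes\mathcal G_h$, $\mathscr L_h=I_{N_t}\otimes\mathcal L_h$, and $V\in\mathbb R^{N_tn}$ is a constant vector. With $J_f=cI$, put $\mathscr M=\mathscr D+ah_t\mathscr G_h\mathscr L_h+bch_t\mathscr G_h$ (which is invertible) and $\widehat F(U)=\mathscr M^{-1}F(U)$. The remainder is $R(U)=f(U)-f(\overline U)-c(U-\overline U)$ for a fixed reference point $\overline U$; it acts entrywise as $u\mapsto f(u)-cu$ up to additive constants, and $\mathrm{Lip}(R)$ is the Lipschitz constant of $u\mapsto f(u)-cu$ on $\mathbb R$. $\|\cdot\|$ is the Euclidean norm; $\sigma_{\min},\sigma_{\max}$ are smallest and largest singular values; the infimum and supremum are over $U\in\mathbb R^{N_tn}$. *)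

theory Defs
  imports "HOL-Analysis.Analysis"
begin

definition self_adjoint :: "real^'n^'n \<Rightarrow> bool" where
  "self_adjoint A \<longleftrightarrow> transpose A = A"

definition nonneg_definite :: "real^'n^'n \<Rightarrow> bool" where
  "nonneg_definite A \<longleftrightarrow> (\<forall>v. 0 \<le> v \<bullet> (A *v v))"

(* The eigenvalues of A^T A are real and nonnegative, so it is enough to look for real ones;
   there are finitely many of them and at least one, so Min and Max below are genuine. *)
definition singular_values :: "real^'n^'n \<Rightarrow> real set" where
  "singular_values A = sqrt ` {l. \<exists>v. v \<noteq> 0 \<and> (transpose A ** A) *v v = l *\<^sub>R v}"

definition sigma_min :: "real^'n^'n \<Rightarrow> real" where
  "sigma_min A = Min (singular_values A)"

definition sigma_max :: "real^'n^'n \<Rightarrow> real" where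
  "sigma_max A = Max (singular_values A)"

(* The smallest Lipschitz constant; only meaningful for functions that are Lipschitz on UNIV. *)
definition Lip :: "(real \<Rightarrow> real) \<Rightarrow> real" where
  "Lip g = Inf {C. C-lipschitz_on UNIV g}"

definition kron :: "real^'m^'m \<Rightarrow> real^'n^'n \<Rightarrow> real^('m \<times> 'n)^('m \<times> 'n)" where
  "kron A B = (\<chi> i j. A $ fst i $ fst j * B $ snd i $ snd j)"

(* The time steps 1, ..., N_t are the elements of the finite linear order 't in increasing order,
   with N_t = CARD('t). As card {..<i} is the number of steps before i, the second case says
   that j is the step immediately before i. *)
definition time_diff :: "real^('t::{finite,linorder})^('t::{finite,linorder})" where
  "time_diff = (\<chi> i j. if i = j then 1
                       else if card {..<i} = Suc (card {..<j}) then -1 else 0)"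

definition entrywise :: "(real \<Rightarrow> real) \<Rightarrow> real^'n \<Rightarrow> real^'n" where
  "entrywise f U = (\<chi> i. f (U $ i))"

(* The spatial matrices G, L act within each time step. *)
definition residual ::
  "real \<Rightarrow> real \<Rightarrow> (real \<Rightarrow> real) \<Rightarrow> real^'n^'n \<Rightarrow> real^'n^'n \<Rightarrow> real \<Rightarrow> real^('t \<times> 'n)
     \<Rightarrow> real^('t \<times> 'n) \<Rightarrow> real^('t::{finite,linorder} \<times> 'n)" where
  "residual a b f G L ht V U =
     kron time_diff (mat 1) *v U
     + ht *\<^sub>R (kron (mat 1) G *v (a *\<^sub>R (kron (mat 1) L *v U) + b *\<^sub>R entrywise f U))
     - V"

definition precond ::
  "real \<Rightarrow> real \<Rightarrow> real \<Rightarrow> real^'n^'n \<Rightarrow> real^'n^'n \<Rightarrow> real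
     \<Rightarrow> real^('t \<times> 'n)^('t::{finite,linorder} \<times> 'n)" where
  "precond a b c G L ht =
     kron time_diff (mat 1)
     + (a * ht) *\<^sub>R (kron (mat 1) G ** kron (mat 1) L)
     + (b * c * ht) *\<^sub>R kron (mat 1) G"

definition precond_residual ::
  "real \<Rightarrow> real \<Rightarrow> real \<Rightarrow> (real \<Rightarrow> real) \<Rightarrow> real^'n^'n \<Rightarrow> real^'n^'n \<Rightarrow> real \<Rightarrow> real^('t \<times> 'n)
     \<Rightarrow> real^('t \<times> 'n) \<Rightarrow> real^('t::{finite,linorder} \<times> 'n)" where
  "precond_residual a b c f G L ht V U =
     matrix_inv (precond a b c G L ht) *v residual a b f G L ht V U"

definition pdhg_flow ::
  "(real^'m \<Rightarrow> real^'m) \<Rightarrow> real \<Rightarrow> real \<Rightarrow> (real \<Rightarrow> real^'m) \<Rightarrow> (real \<Rightarrow> real^'m) \<Rightarrow> bool" where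
  "pdhg_flow F \<epsilon> \<gamma> U Q \<longleftrightarrow>
     (\<forall>t\<ge>0.
        (Q has_vector_derivative (- \<epsilon> *\<^sub>R Q t + F (U t))) (at t within {0..}) \<and>
        (U has_vector_derivative
           - (transpose (jacobian F (at (U t))) *v ((1 - \<gamma> * \<epsilon>) *\<^sub>R Q t + \<gamma> *\<^sub>R F (U t))))
          (at t within {0..}))"

end

(* The preconditioner is an implicit Euler scheme in time. Each of its steps is a contraction in the
   previous state, and it amplifies the source by at most 1 if G = I, and by at most
   1 / (2 sqrt (a ht) + b c ht) if G = L; hence D Fhat differs from the identity by at most theta in
   operator norm and its singular values lie in [1 - theta, 1 + theta].

   Along the flow, |Fhat|^2 + mu |Q|^2 with mu = min (s^2) (1 + theta), s the infimum of the
   singular values, decays exponentially: its dissipation is affine in D Fhat (D Fhat)^T, so it is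
   enough to check the positivity of a 2x2 form at the two extreme values s^2 and S^2 of that
   operator. The weight mu = s^2 makes both forms positive, but the initial energy
   must stay below |Fhat(U_0)|^2 + (1 + theta) |Q_0|^2, which forces the truncation. *)
theory Submission
  imports Defs
begin

subsection \<open>The quadratic forms at the extreme singular values\<close>

text \<open>Everything is expressed through \<open>p = s / S\<close>, the inverse condition number:
  \<open>\<gamma> = p - p^2/2\<close>, \<open>\<epsilon> = 1/p - 1/2\<close>, and hence
  \<open>1 - \<gamma> * \<epsilon> = p - p^2/4\<close>. The third claim is the determinant condition
  for the symmetric 2x2 form with diagonal \<open>\<gamma> * l - r\<close>,
  \<open>\<mu> * (\<epsilon> - r)\<close> and off-diagonal entry
  \<open>-(\<mu> - (1 - \<gamma> * \<epsilon>) * l) / 2\<close>.\<close>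

lemma decay_coefficients:
  fixes s S \<theta> \<kappa> \<epsilon> \<gamma> r \<mu> l :: real
  assumes \<theta>: "0 \<le> \<theta>" "\<theta> < 1" and s: "1 - \<theta> \<le> s" and sS: "s \<le> S" and S: "S \<le> 1 + \<theta>"
    and \<kappa>: "\<kappa> = S / s" and \<epsilon>: "\<epsilon> = \<kappa> - 1 / 2" and \<gamma>: "\<gamma> = 1 / \<kappa> - 1 / (2 * \<kappa>\<^sup>2)"
    and r: "r = 5 / 32 * ((1 - \<theta>) ^ 3 / (1 + \<theta>))" and \<mu>: "\<mu> = min (s\<^sup>2) (1 + \<theta>)"
    and l: "l = s\<^sup>2 \<or> l = S\<^sup>2"
  shows "r \<le> \<gamma> * l" "r \<le> \<epsilon>"
    "(\<mu> - (1 - \<gamma> * \<epsilon>) * l)\<^sup>2 \<le> 4 * (\<gamma> * l - r) * (\<mu> * (\<epsilon> - r))"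
proof -
  have s0: "0 < s" and S0: "0 < S" using \<theta> s sS by auto
  define p where "p = s / S"
  have p0: "0 < p" and p1: "p \<le> 1" using s0 S0 sS by (auto simp: p_def)
  have \<kappa>p: "\<kappa> = 1 / p" using \<kappa> p_def by simp
  have Sp: "S = s / p" using s0 S0 by (simp add: p_def)
  have \<gamma>p: "\<gamma> = p - p\<^sup>2 / 2" using \<gamma> by (simp add: \<kappa>p power_divide)
  have \<epsilon>p: "\<epsilon> = 1 / p - 1 / 2" using \<epsilon> \<kappa>p by simp
  have w: "1 - \<gamma> * \<epsilon> = p - p\<^sup>2 / 4"
    using p0 by (simp add: \<gamma>p \<epsilon>p field_simps power2_eq_square)
  have p2: "p\<^sup>2 \<le> p" using p0 p1 by (simp add: power2_eq_square mult_left_le)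
  have \<epsilon>2: "1 / 2 \<le> \<epsilon>" using p0 p1 by (simp add: \<epsilon>p field_simps)
  have r1: "(1 - \<theta>) ^ 3 / (1 + \<theta>) \<le> 1"
  proof -
    have "(1 - \<theta>) ^ 3 \<le> 1" using \<theta> by (intro power_le_one) auto
    then show ?thesis using \<theta> by (simp add: divide_simps)
  qed
  have r532: "r \<le> 5 / 32" unfolding r using r1 by linarith
  have r0: "0 \<le> r" using \<theta> r by simp
  show re: "r \<le> \<epsilon>" using r532 \<epsilon>2 by simp
  have "r \<le> \<gamma> * l \<and> (\<mu> - (1 - \<gamma> * \<epsilon>) * l)\<^sup>2 \<le> 4 * (\<gamma> * l - r) * (\<mu> * (\<epsilon> - r))"
  proof (cases "s\<^sup>2 \<le> 1 + \<theta>")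
    case True
    then have \<mu>s: "\<mu> = s\<^sup>2" using \<mu> by simp
    define y where "y = s\<^sup>2"
    have y0: "0 < y" and y2: "y \<le> 2" using s0 True \<theta> by (auto simp: y_def)
    \<comment> \<open>The shape of the rate comes from here: \<open>s^3 / S = y * p\<close> scales
      like \<open>\<gamma> * s^2 = y * p * (1 - p/2)\<close>. The case assumption gives
      \<open>y \<le> 2\<close>, which turns the bound on \<open>r\<close> into one by
      \<open>p\<close> alone.\<close>
    have "(1 - \<theta>) ^ 3 / (1 + \<theta>) \<le> s ^ 3 / S"
      using \<theta> s S s0 S0 by (intro frac_le power_mono) auto
    also have "s ^ 3 / S = y * p" by (simp add: y_def p_def power3_eq_cube power2_eq_square)
    finally have ry: "r \<le> 5 / 32 * (y * p)" unfolding r by linarith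
    have "y * p \<le> 2 * p" using y2 p0 by (intro mult_right_mono) auto
    then have rp: "r \<le> 5 / 16 * p" using ry by simp
    have C: "1 - p / 2 - 5 / 16 * p\<^sup>2 \<le> p * (\<epsilon> - r)"
    proof -
      have "p * r \<le> p * (5 / 16 * p)" using rp p0 by (intro mult_left_mono) auto
      then show ?thesis using p0 by (simp add: \<epsilon>p right_diff_distrib power2_eq_square)
    qed
    \<comment> \<open>An equality at \<open>p = 1\<close>, as is \<open>A1\<close> below. Together
      the two constants give 4 * (11/16) * (3/8) = 33/32, just above the required 1.\<close>
    have Cge: "3 / 8 * (1 - p / 2) \<le> 1 - p / 2 - 5 / 16 * p\<^sup>2" using p2 p1 by argo
    have C0: "0 \<le> 1 - p / 2 - 5 / 16 * p\<^sup>2" using Cge p1 by argo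
    from l show ?thesis
    proof
      assume "l = s\<^sup>2"
      then have ly: "l = y" by (simp add: y_def)
      \<comment> \<open>Since \<open>\<gamma> * l = y * p * (1 - p/2)\<close> and \<open>r\<close>
        is at most 5/32 of \<open>y * p\<close>, the constant is 1 - 5/32 = 27/32.\<close>
      define A where "A = 27 / 32 - p / 2"
      have A: "y * p * A \<le> \<gamma> * l - r"
        using ry by (simp add: A_def \<gamma>p ly algebra_simps power2_eq_square)
      have A1: "11 / 16 * (1 - p / 2) \<le> A" using p1 by (simp add: A_def)
      have A0: "0 \<le> A" using p1 by (simp add: A_def)
      have "0 \<le> y * p * A" using y0 p0 A0 by simp
      then have rl: "r \<le> \<gamma> * l" using A by linarith
      \<comment> \<open>As 1 - p + p^2/4 = (1 - p/2)^2, the left side is a fourth power; giving up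
        two of the factors leaves the square that both linear lower bounds can absorb.\<close>
      have "(1 - (p - p\<^sup>2 / 4))\<^sup>2 = ((1 - p / 2)\<^sup>2)\<^sup>2"
        by (simp add: power2_eq_square algebra_simps)
      also have "\<dots> \<le> (1 - p / 2)\<^sup>2 * 1"
        unfolding power2_eq_square[of "(1 - p / 2)\<^sup>2"]
        using p0 p1 by (intro mult_left_mono power_le_one) auto
      also have "\<dots> \<le> 33 / 32 * (1 - p / 2)\<^sup>2" by simp
      also have "\<dots> = 4 * ((11 / 16 * (1 - p / 2)) * (3 / 8 * (1 - p / 2)))"
        by (simp add: power2_eq_square field_simps)
      also have "\<dots> \<le> 4 * (A * (1 - p / 2 - 5 / 16 * p\<^sup>2))"
        using A1 Cge p1 A0 by (intro mult_left_mono mult_mono) auto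
      finally have key: "(1 - (p - p\<^sup>2 / 4))\<^sup>2 \<le> 4 * (A * (1 - p / 2 - 5 / 16 * p\<^sup>2))" .
      have "(\<mu> - (1 - \<gamma> * \<epsilon>) * l)\<^sup>2 = y\<^sup>2 * (1 - (p - p\<^sup>2 / 4))\<^sup>2"
        by (simp add: w ly \<mu>s flip: y_def power_mult_distrib) (simp add: algebra_simps)
      also have "\<dots> \<le> y\<^sup>2 * (4 * (A * (1 - p / 2 - 5 / 16 * p\<^sup>2)))"
        using key by (intro mult_left_mono) auto
      also have "\<dots> \<le> y\<^sup>2 * (4 * (A * (p * (\<epsilon> - r))))"
        using C A0 by (intro mult_left_mono) auto
      also have "\<dots> = 4 * (y * p * A) * (\<mu> * (\<epsilon> - r))"
        unfolding \<mu>s y_def[symmetric] by (simp add: power2_eq_square)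
      also have "\<dots> \<le> 4 * (\<gamma> * l - r) * (\<mu> * (\<epsilon> - r))"
        using A re y0 by (intro mult_right_mono mult_left_mono mult_nonneg_nonneg) (auto simp: \<mu>s)
      finally show ?thesis using rl by blast
    next
      assume "l = S\<^sup>2"
      then have ly: "l * p\<^sup>2 = y" using p0 by (simp add: y_def Sp power_divide)
      \<comment> \<open>Here \<open>l\<close> is \<open>y / p^2\<close>, so each factor of the
        inequality is multiplied by \<open>p\<close> and the common \<open>p^2\<close> is cancelled
        only at the end.\<close>
      define A where "A = 1 - p / 2 - 5 / 32 * p\<^sup>2"
      have A: "y * A \<le> p * (\<gamma> * l - r)"
      proof -
        have "p * r \<le> p * (5 / 32 * (y * p))" using ry p0 by (intro mult_left_mono) auto
        moreover have "p * (\<gamma> * l) = (1 - p / 2) * y"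
          unfolding ly[symmetric] by (simp add: \<gamma>p algebra_simps power2_eq_square)
        ultimately show ?thesis by (simp add: A_def algebra_simps power2_eq_square)
      qed
      have CA: "1 - p / 2 - 5 / 16 * p\<^sup>2 \<le> A" by (simp add: A_def)
      have A0: "0 \<le> A" using CA C0 by argo
      have "0 \<le> p * (\<gamma> * l - r)" using A y0 A0 by (meson mult_nonneg_nonneg less_imp_le order_trans)
      then have rl: "r \<le> \<gamma> * l" using p0 by (simp add: zero_le_mult_iff)
      \<comment> \<open>Both diagonal coefficients are at least \<open>1 - p/2 - 5/16 * p^2\<close>,
        so it suffices that this quantity dominates the off-diagonal one.\<close>
      have "\<bar>(5 / 4 * p - 1) / 2\<bar> \<le> \<bar>1 - p / 2 - 5 / 16 * p\<^sup>2\<bar>"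
        using C0 p2 p0 p1 unfolding abs_le_iff by argo
      then have "((5 / 4 * p - 1) / 2)\<^sup>2 \<le> (1 - p / 2 - 5 / 16 * p\<^sup>2)\<^sup>2"
        by (simp only: abs_le_square_iff)
      also have "\<dots> \<le> A * (1 - p / 2 - 5 / 16 * p\<^sup>2)"
        unfolding power2_eq_square[of "1 - p / 2 - 5 / 16 * p\<^sup>2"]
        using CA C0 by (intro mult_right_mono) auto
      finally have key: "(5 / 4 * p - 1)\<^sup>2 \<le> 4 * (A * (1 - p / 2 - 5 / 16 * p\<^sup>2))"
        by (simp add: power_divide)
      have "p * (\<mu> - (1 - \<gamma> * \<epsilon>) * l) = y * p - (1 - p / 4) * (l * p\<^sup>2)"
        unfolding w \<mu>s y_def[symmetric] by (simp add: algebra_simps power2_eq_square)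
      also have "\<dots> = y * (5 / 4 * p - 1)" by (simp add: ly algebra_simps)
      finally have "p\<^sup>2 * (\<mu> - (1 - \<gamma> * \<epsilon>) * l)\<^sup>2 = y\<^sup>2 * (5 / 4 * p - 1)\<^sup>2"
        by (metis power_mult_distrib)
      also have "\<dots> \<le> y\<^sup>2 * (4 * (A * (1 - p / 2 - 5 / 16 * p\<^sup>2)))"
        using key by (intro mult_left_mono) auto
      also have "\<dots> \<le> y\<^sup>2 * (4 * (A * (p * (\<epsilon> - r))))"
        using C A0 by (intro mult_left_mono) auto
      also have "\<dots> = 4 * (y * A) * (\<mu> * (p * (\<epsilon> - r)))"
        unfolding \<mu>s y_def[symmetric] by (simp add: power2_eq_square)
      also have "\<dots> \<le> 4 * (p * (\<gamma> * l - r)) * (\<mu> * (p * (\<epsilon> - r)))"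
        using A re y0 p0 by (intro mult_right_mono mult_left_mono mult_nonneg_nonneg) (auto simp: \<mu>s)
      also have "\<dots> = p\<^sup>2 * (4 * (\<gamma> * l - r) * (\<mu> * (\<epsilon> - r)))"
        by (simp add: power2_eq_square)
      finally show ?thesis using rl p0 by simp
    qed
  next
    \<comment> \<open>Now all singular values are squeezed: S^2 is at most m^2 and m^2 < 2 s^2, so
      p^2 is at least 1/2 and \<open>p\<close> at least 7/10. Crude constants suffice, and
      \<open>z = l / m\<close> stays in [1, 2].\<close>
    case False
    define m where "m = 1 + \<theta>"
    have m: "\<mu> = m" "1 \<le> m" "m < 2" "m < s\<^sup>2" using False \<mu> \<theta> by (auto simp: m_def)
    have S2: "S\<^sup>2 \<le> m\<^sup>2" using S S0 by (intro power_mono) (auto simp: m_def)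
    have s2: "s\<^sup>2 \<le> S\<^sup>2" using s0 sS by (intro power_mono) auto
    define z where "z = l / m"
    have lz: "l = m * z" using m by (simp add: z_def)
    have z: "1 \<le> z" "z \<le> 2"
    proof -
      have "m \<le> l" "l \<le> m\<^sup>2" using l m S2 s2 by auto
      then show "1 \<le> z" using m by (simp add: z_def)
      have "l \<le> m * m" using \<open>l \<le> m\<^sup>2\<close> by (simp add: power2_eq_square)
      also have "\<dots> \<le> 2 * m" using m by (intro mult_right_mono) auto
      finally have "l \<le> 2 * m" .
      then show "z \<le> 2" using m by (simp add: z_def field_simps)
    qed
    have "1 \<le> 2 * p\<^sup>2"
    proof -
      have "S\<^sup>2 \<le> m * m" using S2 by (simp add: power2_eq_square)
      also have "\<dots> \<le> 2 * s\<^sup>2" using m by (intro mult_mono) auto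
      finally show ?thesis using S0 by (simp add: p_def power_divide divide_simps)
    qed
    then have phalf: "7 / 10 \<le> p" 
    proof -
      have "(7 / 10)\<^sup>2 \<le> p\<^sup>2" using \<open>1 \<le> 2 * p\<^sup>2\<close> by (simp add: power_divide)
      then show ?thesis using p0 by (simp add: power2_le_iff_abs_le)
    qed
    have g: "9 / 20 \<le> \<gamma>"
    proof -
      \<comment> \<open>Completing the square gives \<open>\<gamma> = (1 - (1 - p)^2) / 2\<close>,
        at least 0.455.\<close>
      have "(1 - p)\<^sup>2 \<le> (3 / 10)\<^sup>2" using phalf p1 by (intro power_mono) auto
      then show ?thesis by (simp add: \<gamma>p power2_eq_square algebra_simps)
    qed
    have "\<gamma> * 1 \<le> \<gamma> * z" using g z by (intro mult_left_mono) auto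
    then have gz: "9 / 20 \<le> \<gamma> * z" using g by linarith
    have A: "m * (1 / 4) \<le> \<gamma> * l - r"
    proof -
      have "m * (9 / 20) \<le> m * (\<gamma> * z)" using gz m by (intro mult_left_mono) auto
      moreover have "r \<le> m * (1 / 5)" using r532 m by simp
      ultimately show ?thesis by (simp add: lz algebra_simps)
    qed
    have C: "1 / 4 \<le> \<epsilon> - r" using \<epsilon>2 r532 by simp
    have w1: "1 / 2 \<le> p - p\<^sup>2 / 4" "p - p\<^sup>2 / 4 \<le> 3 / 4"
    proof -
      show "1 / 2 \<le> p - p\<^sup>2 / 4" using phalf p1 p2 by argo
      have "0 \<le> (1 - p) * (3 - p)" using p1 by (intro mult_nonneg_nonneg) auto
      then show "p - p\<^sup>2 / 4 \<le> 3 / 4" by (simp add: power2_eq_square algebra_simps)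
    qed
    define q where "q = (p - p\<^sup>2 / 4) * z"
    have "q \<le> 3 / 4 * 2" unfolding q_def using w1 z by (intro mult_mono) auto
    moreover have "1 / 2 * 1 \<le> q" unfolding q_def using w1 z by (intro mult_mono) auto
    ultimately have "\<bar>1 - q\<bar> \<le> \<bar>1 / 2\<bar>" by linarith
    then have key: "(1 - q)\<^sup>2 \<le> (1 / 2)\<^sup>2" by (simp only: abs_le_square_iff)
    have "(\<mu> - (1 - \<gamma> * \<epsilon>) * l)\<^sup>2 = m\<^sup>2 * (1 - q)\<^sup>2"
      unfolding w lz m(1) q_def by (simp flip: power_mult_distrib) (simp add: algebra_simps)
    also have "\<dots> \<le> m\<^sup>2 * (1 / 2)\<^sup>2" using key by (intro mult_left_mono) auto
    also have "\<dots> = 4 * (m * (1 / 4)) * (\<mu> * (1 / 4))" by (simp add: m(1) power2_eq_square)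
    also have "\<dots> \<le> 4 * (\<gamma> * l - r) * (\<mu> * (\<epsilon> - r))"
      using A C m by (intro mult_mono) auto
    finally show ?thesis using A m by simp
  qed
  then show "r \<le> \<gamma> * l" "(\<mu> - (1 - \<gamma> * \<epsilon>) * l)\<^sup>2 \<le> 4 * (\<gamma> * l - r) * (\<mu> * (\<epsilon> - r))" by auto
qed

text \<open>The expression is the trace of the product of two positive semidefinite matrices, with
  entries \<open>A\<close>, \<open>B\<close>, \<open>C\<close> and \<open>X\<close>,
  \<open>Y\<close>, \<open>Z\<close>: |B Y| is at most the geometric mean of \<open>A * X\<close>
  and \<open>C * Z\<close>, hence at most half their sum.\<close>

lemma trace_product_nonneg:
  fixes A B C X Y Z :: real
  assumes "0 \<le> A" "0 \<le> C" "B\<^sup>2 \<le> A * C" "0 \<le> X" "0 \<le> Z" "Y\<^sup>2 \<le> X * Z"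
  shows "0 \<le> A * X + 2 * B * Y + C * Z"
proof -
  have "(B * Y)\<^sup>2 \<le> (A * C) * (X * Z)"
    unfolding power_mult_distrib using assms by (intro mult_mono) auto
  moreover have "4 * ((A * C) * (X * Z)) \<le> (A * X + C * Z)\<^sup>2"
  proof -
    have "(A * X + C * Z)\<^sup>2 = (A * X - C * Z)\<^sup>2 + 4 * ((A * C) * (X * Z))"
      by (simp add: power2_eq_square algebra_simps)
    then show ?thesis by simp
  qed
  moreover have "(2 * B * Y)\<^sup>2 = 4 * (B * Y)\<^sup>2" by (simp add: power_mult_distrib)
  ultimately have "(2 * B * Y)\<^sup>2 \<le> (A * X + C * Z)\<^sup>2" by linarith
  then have "\<bar>2 * B * Y\<bar> \<le> \<bar>A * X + C * Z\<bar>" by (simp only: abs_le_square_iff)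
  moreover have "0 \<le> A * X + C * Z" using assms by simp
  ultimately show ?thesis by linarith
qed

lemma discriminant_le:
  fixes X Y Z :: real
  assumes "\<And>t. 0 \<le> X + 2 * t * Y + t\<^sup>2 * Z"
  shows "Y\<^sup>2 \<le> X * Z"
proof (cases "Z = 0")
  case True
  have "Y = 0"
  proof (rule ccontr)
    assume "Y \<noteq> 0"
    with assms[of "- (X + 1) / (2 * Y)"] True show False by (simp add: field_simps)
  qed
  then show ?thesis using True by simp
next
  case False
  have "0 \<le> Z"
  proof (rule ccontr)
    assume "\<not> 0 \<le> Z"
    then have Z: "Z < 0" by simp
    have "0 \<le> X" using assms[of 0] by simp
    \<comment> \<open>Averaging the hypothesis over t and -t removes the linear term. The chosen t^2
      leaves \<open>X + Z - \<bar>X\<bar>\<close>, which is negative.\<close>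
    have "0 \<le> X + (1 + \<bar>X\<bar> / - Z) * Z"
      using assms[of "sqrt (1 + \<bar>X\<bar>/ -Z)"] assms[of "- sqrt (1 + \<bar>X\<bar>/ -Z)"] Z
      by (simp add: divide_nonneg_pos)
    then show False using Z \<open>0 \<le> X\<close> by (simp add: field_simps)
  qed
  with False have "0 < Z" by simp
  with assms[of "- Y / Z"] show ?thesis
    by (simp add: field_simps power2_eq_square)
qed

text \<open>The form is affine in A^T A, whose spectrum lies between s^2 and S^2. Multiplied by S^2
  - s^2 it becomes a sum of two traces, each pairing the coefficient matrix at one extreme value
  with a positive semidefinite Gram matrix of \<open>u\<close> and \<open>v\<close>.\<close>

lemma dissipation_form_nonneg:
  fixes u v :: "'a::real_inner" and A :: "'a \<Rightarrow> 'b::real_inner"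
  assumes lin: "linear A" and s0: "0 \<le> s"
    and lo: "\<And>x. s * norm x \<le> norm (A x)" and hi: "\<And>x. norm (A x) \<le> S * norm x"
    and sS: "s \<le> S" and D0: "0 \<le> D"
    and A: "\<And>l. l = s\<^sup>2 \<or> l = S\<^sup>2 \<Longrightarrow> r \<le> \<gamma> * l"
    and B: "\<And>l. l = s\<^sup>2 \<or> l = S\<^sup>2 \<Longrightarrow> (\<mu> - w * l)\<^sup>2 \<le> 4 * (\<gamma> * l - r) * D"
  shows "0 \<le> \<gamma> * (norm (A u))\<^sup>2 - r * (norm u)\<^sup>2 + w * (A u \<bullet> A v) - \<mu> * (u \<bullet> v) + D * (norm v)\<^sup>2"
proof -
  interpret linear A by (rule lin)
  define uu where "uu = (norm (A u))\<^sup>2"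
  define vv where "vv = (norm (A v))\<^sup>2"
  define uv where "uv = A u \<bullet> A v"
  have low: "s\<^sup>2 * (norm x)\<^sup>2 \<le> (norm (A x))\<^sup>2" for x
    using power_mono[OF lo[of x], of 2] s0 by (simp add: power_mult_distrib)
  have high: "(norm (A x))\<^sup>2 \<le> S\<^sup>2 * (norm x)\<^sup>2" for x
    using power_mono[OF hi[of x], of 2] by (simp add: power_mult_distrib)
  have n1: "(norm (u + t *\<^sub>R v))\<^sup>2 = (norm u)\<^sup>2 + 2 * t * (u \<bullet> v) + t\<^sup>2 * (norm v)\<^sup>2" for t
    unfolding power2_norm_eq_inner by (simp add: inner_add inner_commute power2_eq_square algebra_simps)
  have n2: "(norm (A (u + t *\<^sub>R v)))\<^sup>2 = uu + 2 * t * uv + t\<^sup>2 * vv" for t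
    unfolding uu_def vv_def uv_def add scale power2_norm_eq_inner
    by (simp add: inner_add inner_commute power2_eq_square algebra_simps)
  \<comment> \<open>\<open>P1\<close> and \<open>P2\<close> are Cauchy-Schwarz inequalities for the
    semi-inner products given by the operators S^2 - A^T A and A^T A - s^2.\<close>
  have P1: "(S\<^sup>2 * (u \<bullet> v) - uv)\<^sup>2 \<le> (S\<^sup>2 * (norm u)\<^sup>2 - uu) * (S\<^sup>2 * (norm v)\<^sup>2 - vv)"
  proof (rule discriminant_le)
    fix t
    show "0 \<le> S\<^sup>2 * (norm u)\<^sup>2 - uu + 2 * t * (S\<^sup>2 * (u \<bullet> v) - uv) + t\<^sup>2 * (S\<^sup>2 * (norm v)\<^sup>2 - vv)"
      using high[of "u + t *\<^sub>R v"] unfolding n1 n2 by (simp add: algebra_simps)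
  qed
  have P2: "(uv - s\<^sup>2 * (u \<bullet> v))\<^sup>2 \<le> (uu - s\<^sup>2 * (norm u)\<^sup>2) * (vv - s\<^sup>2 * (norm v)\<^sup>2)"
  proof (rule discriminant_le)
    fix t
    show "0 \<le> uu - s\<^sup>2 * (norm u)\<^sup>2 + 2 * t * (uv - s\<^sup>2 * (u \<bullet> v)) + t\<^sup>2 * (vv - s\<^sup>2 * (norm v)\<^sup>2)"
      using low[of "u + t *\<^sub>R v"] unfolding n1 n2 by (simp add: algebra_simps)
  qed
  let ?q = "\<lambda>l a b c. (\<gamma> * l - r) * a - (\<mu> - w * l) * b + D * c"
  have q: "0 \<le> ?q l a b c" if "l = s\<^sup>2 \<or> l = S\<^sup>2" "0 \<le> a" "0 \<le> c" "b\<^sup>2 \<le> a * c" for l a b c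
  proof -
    have "(- x / 2)\<^sup>2 = x\<^sup>2 / 4" for x :: real by (simp add: power_divide)
    then have "(- (\<mu> - w * l) / 2)\<^sup>2 \<le> (\<gamma> * l - r) * D"
      using B[OF that(1)] by (simp only:)
    then have "0 \<le> (\<gamma> * l - r) * a + 2 * (- (\<mu> - w * l) / 2) * b + D * c"
      using A[OF that(1)] that D0 by (intro trace_product_nonneg) auto
    moreover have "2 * (- (\<mu> - w * l) / 2) * b = - ((\<mu> - w * l) * b)"
      by (simp add: field_simps)
    ultimately show ?thesis by linarith
  qed
  let ?F = "\<gamma> * uu - r * (norm u)\<^sup>2 + w * uv - \<mu> * (u \<bullet> v) + D * (norm v)\<^sup>2"
  have "0 \<le> ?F"
  proof (cases "s = S")
    \<comment> \<open>The two weights degenerate. Instead \<open>P2\<close> has a vanishing right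
      side, so A^T A acts as s^2 in every term that involves \<open>u\<close>, and one coefficient
      matrix is enough.\<close>
    case True
    have uu: "uu = s\<^sup>2 * (norm u)\<^sup>2"
      using low[of u] high[of u] unfolding True[symmetric] uu_def by linarith
    have "(uv - s\<^sup>2 * (u \<bullet> v))\<^sup>2 \<le> 0" using P2 unfolding uu by simp
    then have uv: "uv = s\<^sup>2 * (u \<bullet> v)" by simp
    have "0 \<le> ?q (s\<^sup>2) ((norm u)\<^sup>2) (u \<bullet> v) ((norm v)\<^sup>2)"
      using Cauchy_Schwarz_ineq[of u v] by (intro q) (simp_all add: power2_norm_eq_inner)
    also have "\<dots> = ?F" unfolding uu uv by (simp add: algebra_simps)
    finally show ?thesis .
  next
    case False
    have "0 < S\<^sup>2 - s\<^sup>2" using False sS s0 by (simp add: power_strict_mono)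
    moreover have "0 \<le> ?q (s\<^sup>2) (S\<^sup>2 * (norm u)\<^sup>2 - uu) (S\<^sup>2 * (u \<bullet> v) - uv) (S\<^sup>2 * (norm v)\<^sup>2 - vv)"
      using high[of u] high[of v] P1 unfolding uu_def vv_def by (intro q) simp_all
    moreover have "0 \<le> ?q (S\<^sup>2) (uu - s\<^sup>2 * (norm u)\<^sup>2) (uv - s\<^sup>2 * (u \<bullet> v)) (vv - s\<^sup>2 * (norm v)\<^sup>2)"
      using low[of u] low[of v] P2 unfolding uu_def vv_def by (intro q) simp_all
    \<comment> \<open>an operator between \<open>s\<^sup>2\<close> and \<open>S\<^sup>2\<close> is a convex combination of the two,
      with the operator weights \<open>S\<^sup>2 - A\<^sup>T A\<close> and \<open>A\<^sup>T A - s\<^sup>2\<close>\<close>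
    moreover have "(S\<^sup>2 - s\<^sup>2) * ?F
        = ?q (s\<^sup>2) (S\<^sup>2 * (norm u)\<^sup>2 - uu) (S\<^sup>2 * (u \<bullet> v) - uv) (S\<^sup>2 * (norm v)\<^sup>2 - vv)
        + ?q (S\<^sup>2) (uu - s\<^sup>2 * (norm u)\<^sup>2) (uv - s\<^sup>2 * (u \<bullet> v)) (vv - s\<^sup>2 * (norm v)\<^sup>2)"
      by (simp add: algebra_simps)
    ultimately show ?thesis by (smt (verit) zero_le_mult_iff)
  qed
  then show ?thesis by (simp add: uu_def uv_def)
qed

subsection \<open>Singular values\<close>

lemma inner_transpose_mult:
  fixes A :: "real^'n^'n"
  shows "(transpose A *v x) \<bullet> y = x \<bullet> (A *v y)"
  by (simp add: dot_lmul_matrix)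

text \<open>Eigenvectors for distinct eigenvalues are orthogonal; picking one for each eigenvalue
  gives a pairwise orthogonal set, which is finite in finite dimension.\<close>

lemma finite_eigenvalues_symmetric:
  fixes B :: "real^'n^'n"
  assumes sym: "\<And>x y. (B *v x) \<bullet> y = x \<bullet> (B *v y)"
  shows "finite {l. \<exists>v. v \<noteq> 0 \<and> B *v v = l *\<^sub>R v}" (is "finite ?E")
proof -
  have "\<forall>l\<in>?E. \<exists>v. v \<noteq> 0 \<and> B *v v = l *\<^sub>R v" by blast
  then obtain e where e: "\<And>l. l \<in> ?E \<Longrightarrow> e l \<noteq> 0 \<and> B *v e l = l *\<^sub>R e l"
    by (metis (no_types, lifting) bchoice)
  have orth: "e l \<bullet> e k = 0" if "l \<in> ?E" "k \<in> ?E" "l \<noteq> k" for l k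
    using sym[of "e l" "e k"] e[OF that(1)] e[OF that(2)] that(3) by simp
  have inj: "inj_on e ?E"
    by (rule inj_onI) (metis (no_types, lifting) orth e inner_eq_zero_iff)
  have "pairwise orthogonal (e ` ?E)"
    using orth by (auto simp: pairwise_def orthogonal_def)
  then have "finite (e ` ?E)" by (rule pairwise_orthogonal_imp_finite)
  then show ?thesis using inj finite_image_iff by blast
qed

text \<open>First variation: along \<open>v + t h\<close> the quadratic in t keeps one sign and
  vanishes at t = 0, so its linear coefficient is zero for every \<open>h\<close>. The sign of
  \<open>\<tau>\<close> lets the same argument serve minimizers and maximizers.\<close>

lemma extremal_quotient_eigenvector:
  fixes A :: "real^'n^'n"
  assumes nn: "\<And>x. 0 \<le> \<tau> * ((norm (A *v x))\<^sup>2 - l * (norm x)\<^sup>2)" and \<tau>: "\<tau> \<noteq> 0"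
    and v: "(norm (A *v v))\<^sup>2 = l * (norm v)\<^sup>2"
  shows "(transpose A ** A) *v v = l *\<^sub>R v"
proof -
  have "((transpose A ** A) *v v - l *\<^sub>R v) \<bullet> h = 0" for h
  proof -
    define Y where "Y = (A *v v) \<bullet> (A *v h) - l * (v \<bullet> h)"
    define Z where "Z = (norm (A *v h))\<^sup>2 - l * (norm h)\<^sup>2"
    have "0 \<le> 0 + 2 * t * (\<tau> * Y) + t\<^sup>2 * (\<tau> * Z)" for t
    proof -
      have "(norm (A *v (v + t *\<^sub>R h)))\<^sup>2 - l * (norm (v + t *\<^sub>R h))\<^sup>2
          = ((norm (A *v v))\<^sup>2 - l * (norm v)\<^sup>2) + 2 * t * Y + t\<^sup>2 * Z"
        unfolding Y_def Z_def power2_norm_eq_inner matrix_vector_right_distrib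
          matrix_vector_mult_scaleR
        by (simp add: inner_add inner_commute power2_eq_square algebra_simps)
      then show ?thesis using nn[of "v + t *\<^sub>R h"] v by (simp add: algebra_simps)
    qed
    then have "(\<tau> * Y)\<^sup>2 \<le> 0 * (\<tau> * Z)" by (rule discriminant_le)
    then have "Y = 0" using \<tau> by simp
    then show ?thesis
      by (simp add: Y_def inner_diff_left dot_lmul_matrix flip: matrix_vector_mul_assoc)
  qed
  from this[of "(transpose A ** A) *v v - l *\<^sub>R v"] show ?thesis by simp
qed

lemma finite_singular_values: "finite (singular_values A)"
  unfolding singular_values_def
  by (intro finite_imageI finite_eigenvalues_symmetric)
     (metis inner_transpose_mult matrix_transpose_mul transpose_transpose)

lemma singular_value_norm:
  assumes "\<sigma> \<in> singular_values A"
  obtains v where "norm v = 1" "norm (A *v v) = \<sigma>"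
proof -
  obtain l v where v: "\<sigma> = sqrt l" "v \<noteq> 0" "(transpose A ** A) *v v = l *\<^sub>R v"
    using assms by (auto simp: singular_values_def)
  have "(norm (A *v v))\<^sup>2 = ((transpose A ** A) *v v) \<bullet> v"
    by (simp add: power2_norm_eq_inner dot_lmul_matrix flip: matrix_vector_mul_assoc)
  also have "\<dots> = l * (norm v)\<^sup>2" by (simp add: v(3) power2_norm_eq_inner)
  finally have "norm (A *v v) = \<sigma> * norm v"
    by (metis norm_ge_zero real_sqrt_mult real_sqrt_unique v(1))
  then have "norm (A *v ((1 / norm v) *\<^sub>R v)) = \<sigma>"
    using v(2) by (simp add: matrix_vector_mult_scaleR)
  moreover have "norm ((1 / norm v) *\<^sub>R v) = 1" using v(2) by simp
  ultimately show ?thesis using that by blast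
qed

text \<open>Homogeneity extends extremality from the unit sphere to all vectors, so the
  first-variation argument yields an eigenvector of A^T A. It is applied with
  \<open>\<tau> = 1\<close> at a minimum and with \<open>\<tau> = -1\<close> at a maximum.\<close>

lemma unit_extremum_singular_value:
  fixes A :: "real^'n^'n"
  assumes v: "norm v = 1" and \<tau>: "\<tau> \<noteq> 0"
    and ext: "\<And>x. norm x = 1 \<Longrightarrow> 0 \<le> \<tau> * ((norm (A *v x))\<^sup>2 - (norm (A *v v))\<^sup>2)"
  shows "norm (A *v v) \<in> singular_values A"
proof -
  let ?l = "(norm (A *v v))\<^sup>2"
  have "0 \<le> \<tau> * ((norm (A *v x))\<^sup>2 - ?l * (norm x)\<^sup>2)" for x
  proof (cases "x = 0")
    case False
    have "0 \<le> \<tau> * ((norm (A *v ((1 / norm x) *\<^sub>R x)))\<^sup>2 - ?l)"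
      using False by (intro ext) simp
    then have "0 \<le> (norm x)\<^sup>2 * (\<tau> * ((norm (A *v ((1 / norm x) *\<^sub>R x)))\<^sup>2 - ?l))" by simp
    also have "\<dots> = \<tau> * ((norm (A *v x))\<^sup>2 - ?l * (norm x)\<^sup>2)"
      using False by (simp add: matrix_vector_mult_scaleR power_divide field_simps)
    finally show ?thesis .
  qed simp
  then have "(transpose A ** A) *v v = ?l *\<^sub>R v"
    using \<tau> v by (intro extremal_quotient_eigenvector) auto
  moreover have "v \<noteq> 0" using v by auto
  ultimately have "sqrt ?l \<in> singular_values A" unfolding singular_values_def by blast
  then show ?thesis by simp
qed

lemma norm_mult_le_of_unit:
  fixes A :: "real^'n^'n"
  shows "(\<And>x. norm x = 1 \<Longrightarrow> k \<le> norm (A *v x)) \<Longrightarrow> k * norm x \<le> norm (A *v x)"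
    and "(\<And>x. norm x = 1 \<Longrightarrow> norm (A *v x) \<le> k) \<Longrightarrow> norm (A *v x) \<le> k * norm x"
proof -
  have sc: "norm (A *v ((1 / norm x) *\<^sub>R x)) * norm x = norm (A *v x)" "norm ((1 / norm x) *\<^sub>R x) = 1"
    if "x \<noteq> 0" using that by (simp_all add: matrix_vector_mult_scaleR)
  show "k * norm x \<le> norm (A *v x)" if *: "\<And>x. norm x = 1 \<Longrightarrow> k \<le> norm (A *v x)"
  proof (cases "x = 0")
    case False
    then show ?thesis using mult_right_mono[OF *[OF sc(2)] norm_ge_zero[of x]] sc(1) by simp
  qed simp
  show "norm (A *v x) \<le> k * norm x" if *: "\<And>x. norm x = 1 \<Longrightarrow> norm (A *v x) \<le> k"
  proof (cases "x = 0")
    case False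
    then show ?thesis using mult_right_mono[OF *[OF sc(2)] norm_ge_zero[of x]] sc(1) by simp
  qed simp
qed

lemma unit_sphere_extrema:
  fixes A :: "real^'n^'n"
  obtains v w where "norm v = 1" "norm w = 1"
    "\<And>x. norm x = 1 \<Longrightarrow> norm (A *v v) \<le> norm (A *v x)"
    "\<And>x. norm x = 1 \<Longrightarrow> norm (A *v x) \<le> norm (A *v w)"
proof -
  have c: "compact (sphere (0::real^'n) 1)" by simp
  have ne: "sphere (0::real^'n) 1 \<noteq> {}" using vector_choose_size[of 1] by (auto simp: sphere_def)
  have cont: "continuous_on (sphere 0 1) (\<lambda>x. norm (A *v x))"
    by (intro continuous_intros)
  from continuous_attains_inf[OF c ne cont] continuous_attains_sup[OF c ne cont]
  show ?thesis using that by (auto simp: sphere_def)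
qed

text \<open>By compactness \<open>norm (A *v x)\<close> attains its extrema on the unit sphere, and
  these are singular values. This bounds \<open>Min\<close> and \<open>Max\<close> on the required
  side and also shows that the finite set they range over is nonempty.\<close>

lemma sigma_min_le: "sigma_min A * norm x \<le> norm (A *v x)" (is ?min)
  and sigma_max_ge: "norm (A *v x) \<le> sigma_max A * norm x" (is ?max)
  and sigma_min_in: "sigma_min A \<in> singular_values A" (is ?inmin)
  and sigma_max_in: "sigma_max A \<in> singular_values A" (is ?inmax)
proof -
  obtain v w where v: "norm v = 1" "\<And>x. norm x = 1 \<Longrightarrow> norm (A *v v) \<le> norm (A *v x)"
    and w: "norm w = 1" "\<And>x. norm x = 1 \<Longrightarrow> norm (A *v x) \<le> norm (A *v w)"
    using unit_sphere_extrema[of A] by metis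
  have vin: "norm (A *v v) \<in> singular_values A"
    using v by (intro unit_extremum_singular_value[where \<tau> = 1]) auto
  have win: "norm (A *v w) \<in> singular_values A"
    using w by (intro unit_extremum_singular_value[where \<tau> = "-1"]) auto
  from vin have ne: "singular_values A \<noteq> {}" by blast
  show ?inmin ?inmax
    unfolding sigma_min_def sigma_max_def using finite_singular_values ne by (auto intro: Min_in Max_in)
  have "sigma_min A \<le> norm (A *v v)" "norm (A *v w) \<le> sigma_max A"
    unfolding sigma_min_def sigma_max_def
    by (rule Min_le[OF finite_singular_values vin], rule Max_ge[OF finite_singular_values win])
  then show ?min ?max
    using v w by (auto intro!: norm_mult_le_of_unit intro: order_trans)
qed

lemma norm_transpose_mult_le:
  fixes A :: "real^'n^'n"
  assumes "\<And>x. norm (A *v x) \<le> k * norm x"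
  shows "norm (transpose A *v x) \<le> k * norm x"
proof (cases "transpose A *v x = 0")
  case True
  have "0 \<le> k * norm x" using assms[of x] norm_ge_zero order_trans by blast
  then show ?thesis unfolding True by simp
next
  case False
  let ?y = "transpose A *v x"
  have "norm ?y * norm ?y = x \<bullet> (A *v ?y)"
    unfolding inner_transpose_mult[symmetric] power2_norm_eq_inner[symmetric] by (simp add: power2_eq_square)
  also have "\<dots> \<le> norm x * norm (A *v ?y)" by (rule norm_cauchy_schwarz)
  also have "\<dots> \<le> norm x * (k * norm ?y)" using assms by (intro mult_left_mono) auto
  finally have "norm ?y * norm ?y \<le> (k * norm x) * norm ?y" by (simp add: mult_ac)
  then show ?thesis using False by simp
qed

text \<open>The lower bound makes \<open>A\<close> injective, hence surjective; writing x = A u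
  gives |x|^2 = (A^T x) . u, where |u| is at most |x| / k. The flow drives the residual through J
  J^T, so the bounds on J have to be carried over to its transpose.\<close>

lemma norm_transpose_mult_ge:
  fixes A :: "real^'n^'n"
  assumes k: "0 < k" and le: "\<And>x. k * norm x \<le> norm (A *v x)"
  shows "k * norm x \<le> norm (transpose A *v x)"
proof -
  have "inj ((*v) A)"
  proof (rule injI)
    fix x y assume "A *v x = A *v y"
    then have "A *v (x - y) = 0" by (simp add: matrix_vector_mult_diff_distrib)
    with le[of "x - y"] k have "norm (x - y) \<le> 0" by (simp add: mult_le_0_iff)
    then show "x = y" by simp
  qed
  then have "surj ((*v) A)" by (simp add: linear_injective_imp_surjective)
  then obtain u where u: "x = A *v u" by (metis surjD)
  have "norm x * norm x = (transpose A *v x) \<bullet> u"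
    unfolding inner_transpose_mult u[symmetric] power2_norm_eq_inner[symmetric] by (simp add: power2_eq_square)
  also have "\<dots> \<le> norm (transpose A *v x) * norm u" by (rule norm_cauchy_schwarz)
  finally have "k * (norm x * norm x) \<le> k * (norm (transpose A *v x) * norm u)" using k by simp
  also have "\<dots> = norm (transpose A *v x) * (k * norm u)" by simp
  also have "\<dots> \<le> norm (transpose A *v x) * norm x"
    using le[of u] u by (intro mult_left_mono) auto
  finally show ?thesis by (cases "x = 0") auto
qed

subsection \<open>One implicit time step\<close>

lemma norm_le_norm_add_nonneg:
  fixes z w :: "'a::real_inner"
  assumes "0 \<le> z \<bullet> w"
  shows "norm z \<le> norm (z + w)"
proof -
  have "z \<bullet> z \<le> (z + w) \<bullet> (z + w)" using assms inner_ge_zero[of w]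
    by (simp add: inner_add inner_commute)
  then show ?thesis by (simp add: norm_le)
qed

text \<open>On an eigenvector of \<open>L\<close> with eigenvalue x this reads (2 sqrt \<alpha> +
  \<beta>) x \<le> 1 + \<alpha> x^2 + \<beta> x, the AM-GM inequality. In general the vector on the
  right is tested against \<open>L p\<close>.\<close>

lemma weighted_square_norm_le:
  fixes p :: "'a::real_inner" and L :: "'a \<Rightarrow> 'a"
  assumes lin: "linear L" and sym: "\<And>x y. L x \<bullet> y = x \<bullet> L y" and nn: "\<And>x. 0 \<le> x \<bullet> L x"
    and \<alpha>: "0 \<le> \<alpha>" and \<beta>: "0 \<le> \<beta>"
  shows "(2 * sqrt \<alpha> + \<beta>) * norm (L p) \<le> norm (p + (\<alpha> *\<^sub>R L (L p) + \<beta> *\<^sub>R L p))"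
proof (cases "L p = 0")
  case False
  interpret linear L by (rule lin)
  define q where "q = L p"
  define s where "s = sqrt \<alpha>"
  have s: "s * s = \<alpha>" using \<alpha> by (simp add: s_def)
  \<comment> \<open>AM-GM and Cauchy-Schwarz for the semi-inner product of \<open>L\<close>:
    \<open>2 s \<parallel>L p\<parallel>\<^sup>2 \<le> \<langle>p, L p\<rangle> + s\<^sup>2 \<langle>q, L q\<rangle>\<close>\<close>
  have "0 \<le> (p - s *\<^sub>R q) \<bullet> L (p - s *\<^sub>R q)" by (rule nn)
  also have "\<dots> = p \<bullet> q - 2 * s * (q \<bullet> q) + \<alpha> * (q \<bullet> L q)"
    using sym[of p q]
    by (simp add: diff scale inner_diff s[symmetric] flip: q_def) (simp add: inner_commute algebra_simps)
  finally have "(2 * s + \<beta>) * (q \<bullet> q) \<le> (p + (\<alpha> *\<^sub>R L q + \<beta> *\<^sub>R q)) \<bullet> q"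
    by (simp add: inner_add inner_commute algebra_simps)
  also have "\<dots> \<le> norm (p + (\<alpha> *\<^sub>R L q + \<beta> *\<^sub>R q)) * norm q" by (rule norm_cauchy_schwarz)
  finally have "((2 * s + \<beta>) * norm q) * norm q \<le> norm (p + (\<alpha> *\<^sub>R L q + \<beta> *\<^sub>R q)) * norm q"
    by (simp add: dot_square_norm power2_eq_square mult_ac)
  then show ?thesis using False by (simp add: q_def s_def)
qed simp

text \<open>The step operator N = I + \<alpha> L^2 + \<beta> L commutes with \<open>L\<close>, so z
  = N^-1 \<zeta> + L N^-1 y. The first summand is no longer than \<zeta> because N does not shrink
  vectors; the second carries the gain of the source.\<close>

lemma implicit_step_bound:
  fixes L :: "'a::euclidean_space \<Rightarrow> 'a"
  assumes lin: "linear L" and sym: "\<And>x y. L x \<bullet> y = x \<bullet> L y" and nn: "\<And>x. 0 \<le> x \<bullet> L x"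
    and \<alpha>: "0 \<le> \<alpha>" and \<beta>: "0 \<le> \<beta>" and pos: "0 < 2 * sqrt \<alpha> + \<beta>"
    and z: "z + (\<alpha> *\<^sub>R L (L z) + \<beta> *\<^sub>R L z) = \<zeta> + L y"
  shows "norm z \<le> norm \<zeta> + 1 / (2 * sqrt \<alpha> + \<beta>) * norm y"
proof -
  interpret linear L by (rule lin)
  define N where "N = (\<lambda>z. z + (\<alpha> *\<^sub>R L (L z) + \<beta> *\<^sub>R L z))"
  have linN: "linear N"
    by (rule linearI) (simp_all add: N_def add scale algebra_simps)
  have ge: "norm x \<le> norm (N x)" for x
  proof -
    have "0 \<le> x \<bullet> (\<alpha> *\<^sub>R L (L x) + \<beta> *\<^sub>R L x)"
      using nn[of x] \<alpha> \<beta> sym[of x "L x", symmetric] by (simp add: inner_add_right)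
    then show ?thesis unfolding N_def by (rule norm_le_norm_add_nonneg)
  qed
  have inj: "inj N"
  proof (rule linear_injective_0[OF linN, THEN iffD2], safe)
    fix x assume "N x = 0"
    then show "x = 0" using ge[of x] by simp
  qed
  then have "surj N" by (rule linear_inj_imp_surj[OF linN])
  then obtain p q where p: "N p = y" and q: "N q = \<zeta>" by (metis surjD)
  have "N (q + L p) = N q + L (N p)"
    by (simp add: N_def add scale algebra_simps)
  moreover have "N z = \<zeta> + L y" using z by (simp add: N_def)
  ultimately have "N z = N (q + L p)" using p q by simp
  then have "z = q + L p" using inj by (simp add: inj_eq)
  then have "norm z \<le> norm q + norm (L p)" by (simp add: norm_triangle_ineq)
  also have "norm q \<le> norm \<zeta>" using ge[of q] q by simp
  also have "norm (L p) \<le> 1 / (2 * sqrt \<alpha> + \<beta>) * norm y"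
    using weighted_square_norm_le[OF lin sym nn \<alpha> \<beta>, of p] pos p
    by (simp add: N_def field_simps)
  finally show ?thesis by simp
qed

subsection \<open>The preconditioned residual\<close>

definition slice :: "real^('t \<times> 'n) \<Rightarrow> 't::finite \<Rightarrow> real^'n::finite" where
  "slice U i = (\<chi> x. U $ (i, x))"

lemma norm_sq_vec: "(norm V)\<^sup>2 = (\<Sum>k\<in>UNIV. (V $ k)\<^sup>2)" for V :: "real^'n"
  by (simp add: norm_vec_def L2_set_def sum_nonneg)

lemma norm_slice: "(norm U)\<^sup>2 = (\<Sum>i\<in>UNIV. (norm (slice U i))\<^sup>2)"
proof -
  have "(\<Sum>i\<in>UNIV. \<Sum>x\<in>UNIV. (U $ (i, x))\<^sup>2) = (\<Sum>k\<in>UNIV. (U $ k)\<^sup>2)"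
    by (simp add: sum.cartesian_product case_prod_unfold)
  then show ?thesis by (simp add: norm_sq_vec slice_def)
qed

lemma slice_add: "slice (U + V) i = slice U i + slice V i"
  and slice_scaleR: "slice (k *\<^sub>R U) i = k *\<^sub>R slice U i"
  by (simp_all add: slice_def vec_eq_iff)

lemma slice_kron: "slice (kron A B *v U) i = (\<Sum>j\<in>UNIV. A $ i $ j *\<^sub>R (B *v slice U j))"
  by (simp add: vec_eq_iff slice_def kron_def matrix_vector_mult_def sum_distrib_left mult.assoc
      sum.cartesian_product UNIV_Times_UNIV[symmetric] case_prod_unfold del: UNIV_Times_UNIV)

lemma slice_kron_mat_1: "slice (kron (mat 1) B *v U) i = B *v slice U i"
proof -
  have "slice (kron (mat 1) B *v U) i = (\<Sum>j\<in>UNIV. if j = i then B *v slice U j else 0)"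
    unfolding slice_kron by (intro sum.cong) (auto simp: mat_def)
  then show ?thesis by simp
qed

text \<open>The sum runs over the immediate predecessors of \<open>i\<close>. It has at most one
  term and is empty at the first step, which thus starts from the zero state.\<close>

lemma slice_kron_time_diff:
  "slice (kron time_diff (mat 1) *v U) i
    = slice U i - (\<Sum>j | card {..<i} = Suc (card {..<j}). slice U j)"
proof -
  have "slice (kron time_diff (mat 1) *v U) i
      = (\<Sum>j\<in>UNIV. (if j = i then slice U j else 0)
          - (if card {..<i} = Suc (card {..<j}) then slice U j else 0))"
    unfolding slice_kron by (intro sum.cong) (auto simp: time_diff_def)
  also have "\<dots> = slice U i - (\<Sum>j | card {..<i} = Suc (card {..<j}). slice U j)"
    unfolding sum_subtractf by (simp add: sum.If_cases)
  finally show ?thesis .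
qed

lemma card_lessThan_strict_mono:
  "i < j \<Longrightarrow> card {..<i} < card {..<j::'t::{finite,linorder}}"
  by (rule psubset_card_mono) auto

text \<open>Since no step amplifies the previous state, source contributions simply accumulate. The
  induction is on the number of earlier time steps; this number determines the step, so the
  predecessor is unique.\<close>

lemma time_recursion_bound:
  fixes z :: "'t::{finite,linorder} \<Rightarrow> 'a::real_normed_vector"
  assumes y: "\<And>i. 0 \<le> y i"
    and step: "\<And>i. norm (z i) \<le> norm (\<Sum>j | card {..<i} = Suc (card {..<j}). z j) + y i"
  shows "norm (z i) \<le> (\<Sum>j\<le>i. y j)"
proof (induction "card {..<i}" arbitrary: i)
  case 0
  then have "norm (z i) \<le> y i" using step[of i] by simp
  also have "\<dots> \<le> (\<Sum>j\<le>i. y j)" using y by (intro member_le_sum) auto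
  finally show ?case .
next
  case (Suc n)
  have uniq: "j = k" if "card {..<j} = card {..<k}" for j k :: 't
    using that card_lessThan_strict_mono[of j k] card_lessThan_strict_mono[of k j]
    by (cases j k rule: linorder_cases) auto
  show ?case
  proof (cases "\<exists>j::'t. card {..<i} = Suc (card {..<j})")
    case True
    then obtain j :: 't where j: "card {..<i} = Suc (card {..<j})" by blast
    then have P: "{k. card {..<i} = Suc (card {..<k})} = {j}" using uniq by auto
    have "j < i" using j card_lessThan_strict_mono[of i j] by (cases j i rule: linorder_cases) auto
    have "norm (z i) \<le> norm (z j) + y i" using step[of i] unfolding P by simp
    also have "norm (z j) \<le> (\<Sum>k\<le>j. y k)" using Suc j by auto
    also have "(\<Sum>k\<le>j. y k) + y i = (\<Sum>k\<in>insert i {..j}. y k)"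
      using \<open>j < i\<close> by (simp add: add.commute)
    also have "\<dots> \<le> (\<Sum>k\<le>i. y k)"
      using y \<open>j < i\<close> by (intro sum_mono2) auto
    finally show ?thesis by simp
  next
    case False
    then have "norm (z i) \<le> y i" using step[of i] by simp
    also have "\<dots> \<le> (\<Sum>j\<le>i. y j)" using y by (intro member_le_sum) auto
    finally show ?thesis .
  qed
qed

text \<open>Read slice by slice, the system is one implicit step per time index, and
  \<open>g\<close> is the gain of that step on its source. Every slice of \<open>Z\<close> is
  bounded by the sum of all the sources: Cauchy-Schwarz over the sources costs sqrt N_t, and
  collecting the N_t slices costs another sqrt N_t.\<close>

lemma precond_solution_bound:
  fixes G L :: "real^'n::finite^'n" and Y Z :: "real^('t::{finite,linorder} \<times> 'n::finite)"
  assumes g: "0 \<le> g"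
    and step: "\<And>z \<zeta> y. z + ((a * ht) *\<^sub>R (G *v (L *v z)) + (b * c * ht) *\<^sub>R (G *v z)) = \<zeta> + G *v y
      \<Longrightarrow> norm z \<le> norm \<zeta> + g * norm y"
    and Z: "precond a b c G L ht *v Z = kron (mat 1) G *v Y"
  shows "norm Z \<le> g * real CARD('t) * norm Y"
proof -
  let ?N = "real CARD('t)"
  have "norm (slice Z i) \<le> norm (\<Sum>j | card {..<i} = Suc (card {..<j}). slice Z j) + g * norm (slice Y i)" for i
  proof (rule step)
    have "slice (precond a b c G L ht *v Z) i = slice (kron (mat 1) G *v Y) i" by (simp add: Z)
    then show "slice Z i + ((a * ht) *\<^sub>R (G *v (L *v slice Z i)) + (b * c * ht) *\<^sub>R (G *v slice Z i))
        = (\<Sum>j | card {..<i} = Suc (card {..<j}). slice Z j) + G *v slice Y i"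
      by (simp add: precond_def matrix_vector_mult_add_rdistrib slice_add slice_scaleR slice_kron_mat_1
          slice_kron_time_diff scaleR_matrix_vector_assoc[symmetric] matrix_vector_mul_assoc[symmetric]
          algebra_simps)
  qed
  then have "norm (slice Z i) \<le> (\<Sum>j\<le>i. g * norm (slice Y j))" for i
    using g by (intro time_recursion_bound) auto
  also have "(\<Sum>j\<le>i. g * norm (slice Y j)) \<le> (\<Sum>j\<in>UNIV. g * norm (slice Y j))" for i
    using g by (intro sum_mono2) auto
  finally have le: "norm (slice Z i) \<le> (\<Sum>j\<in>UNIV. g * norm (slice Y j))" for i .
  have "(norm (slice Z i))\<^sup>2 \<le> g\<^sup>2 * (?N * (norm Y)\<^sup>2)" for i
  proof -
    have "(norm (slice Z i))\<^sup>2 \<le> (\<Sum>j\<in>UNIV. g * norm (slice Y j))\<^sup>2"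
      using le by (rule power_mono) auto
    also have "\<dots> = g\<^sup>2 * (\<Sum>j\<in>UNIV. norm (slice Y j) * 1)\<^sup>2"
      by (simp add: sum_distrib_left[symmetric] power_mult_distrib)
    also have "\<dots> \<le> g\<^sup>2 * ((\<Sum>j\<in>UNIV. (norm (slice Y j))\<^sup>2) * (\<Sum>j\<in>(UNIV::'t set). 1\<^sup>2))"
      by (intro mult_left_mono Cauchy_Schwarz_ineq_sum) auto
    finally show ?thesis by (simp add: norm_slice[of Y] mult_ac)
  qed
  then have "(norm Z)\<^sup>2 \<le> (\<Sum>i\<in>(UNIV::'t set). g\<^sup>2 * (?N * (norm Y)\<^sup>2))"
    unfolding norm_slice[of Z] by (rule sum_mono)
  also have "\<dots> = (g * ?N * norm Y)\<^sup>2" by (simp add: power_mult_distrib power2_eq_square)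
  finally show ?thesis by (rule power2_le_imp_le) (use g in simp)
qed

text \<open>The homogeneous system is the case of zero source, so the solution bound makes the
  kernel trivial.\<close>

lemma invertible_precond:
  fixes G L :: "real^'n::finite^'n"
  assumes g: "0 \<le> g"
    and step: "\<And>z \<zeta> y. z + ((a * ht) *\<^sub>R (G *v (L *v z)) + (b * c * ht) *\<^sub>R (G *v z)) = \<zeta> + G *v y
      \<Longrightarrow> norm z \<le> norm \<zeta> + g * norm y"
  shows "invertible (precond a b c G L ht :: real^('t::{finite,linorder} \<times> 'n)^('t \<times> 'n))"
proof -
  have "Z = 0" if "precond a b c G L ht *v Z = 0" for Z :: "real^('t \<times> 'n::finite)"
  proof -
    have "precond a b c G L ht *v Z = kron (mat 1) G *v (0::real^('t \<times> 'n))" using that by simp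
    from precond_solution_bound[OF g step this] show ?thesis by simp
  qed
  then show ?thesis
    using matrix_left_invertible_ker invertible_left_inverse by blast
qed

lemma entrywise_has_derivative:
  assumes "\<And>x. (f has_real_derivative f' x) (at x)"
  shows "(entrywise f has_derivative (\<lambda>h. \<chi> k. f' (U $ k) * h $ k)) (at U)"
proof -
  have "((\<lambda>U. f (U $ k)) has_derivative (\<lambda>h. f' (U $ k) * h $ k)) (at U)" for k
  proof -
    have "(f has_derivative (*) (f' (U $ k))) (at (U $ k))"
      using assms by (simp add: has_field_derivative_def)
    moreover have "((\<lambda>U. U $ k) has_derivative (\<lambda>h. h $ k)) (at U)"
      by (rule bounded_linear.has_derivative[OF bounded_linear_vec_nth has_derivative_ident])
    ultimately show ?thesis
      by (rule has_derivative_compose[rotated])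
  qed
  then show ?thesis
    unfolding entrywise_def has_derivative_componentwise_within[of "\<lambda>U. \<chi> i. f (U $ i)"]
    by (auto simp: Basis_vec_def inner_axis)
qed

text \<open>Splitting f' = c + (f' - c) gathers the constant part into the preconditioner and leaves
  a diagonal perturbation behind \<open>G\<close>, which is the form of the source in
  \<open>precond_solution_bound\<close>.\<close>

lemma residual_has_derivative:
  fixes U :: "real^('t::{finite,linorder} \<times> 'n::finite)"
  assumes f': "\<And>x. (f has_real_derivative f' x) (at x)"
  shows "(residual a b f G L ht V has_derivative
    (\<lambda>h. precond a b c G L ht *v h + kron (mat 1) G *v ((b * ht) *\<^sub>R (\<chi> k. (f' (U $ k) - c) * h $ k)))) (at U)"
proof -
  have ml: "((\<lambda>U. A *v g U) has_derivative (\<lambda>h. A *v g' h)) (at U)"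
    if "(g has_derivative g') (at U)"
    for A :: "real^('t \<times> 'n)^('t \<times> 'n::finite)" and g :: "real^('t \<times> 'n) \<Rightarrow> real^('t \<times> 'n::finite)" and g'
    by (rule bounded_linear.has_derivative[OF matrix_vector_mul_bounded_linear that])
  have "(residual a b f G L ht V has_derivative
      (\<lambda>h. kron time_diff (mat 1) *v h
        + ht *\<^sub>R (kron (mat 1) G *v (a *\<^sub>R (kron (mat 1) L *v h) + b *\<^sub>R (\<chi> k. f' (U $ k) * h $ k)))
        - 0)) (at U)"
    unfolding residual_def
    by (intro has_derivative_diff has_derivative_add has_derivative_scaleR_right ml
        has_derivative_ident has_derivative_const entrywise_has_derivative f')
  moreover have "kron time_diff (mat 1) *v h
        + ht *\<^sub>R (kron (mat 1) G *v (a *\<^sub>R (kron (mat 1) L *v h) + b *\<^sub>R (\<chi> k. f' (U $ k) * h $ k))) - 0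
      = precond a b c G L ht *v h + kron (mat 1) G *v ((b * ht) *\<^sub>R (\<chi> k. (f' (U $ k) - c) * h $ k))"
    for h
  proof -
    define W where "W = (\<chi> k. (f' (U $ k) - c) * h $ k)"
    have "(\<chi> k. f' (U $ k) * h $ k) = W + c *\<^sub>R h"
      by (simp add: W_def vec_eq_iff algebra_simps)
    then show ?thesis unfolding W_def[symmetric]
      by (simp add: precond_def matrix_vector_mult_add_rdistrib scaleR_matrix_vector_assoc[symmetric]
          matrix_vector_mul_assoc[symmetric] matrix_vector_right_distrib matrix_vector_mult_scaleR
          algebra_simps)
  qed
  ultimately show ?thesis by simp
qed

lemma norm_diagonal_mult_le:
  fixes h :: "real^'n"
  assumes "\<And>k. \<bar>d k\<bar> \<le> K" "0 \<le> K"
  shows "norm (\<chi> k. d k * h $ k) \<le> K * norm h"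
proof -
  have "norm (\<chi> k. d k * h $ k) \<le> norm (K *\<^sub>R h)"
    by (rule norm_le_componentwise_cart) (use assms in \<open>auto simp: abs_mult intro!: mult_right_mono\<close>)
  then show ?thesis using assms by simp
qed

lemma matrix_inv_cancel:
  fixes A :: "real^'n^'n"
  assumes "invertible A"
  shows "A *v (matrix_inv A *v x) = x" "matrix_inv A *v (A *v x) = x"
proof -
  have "A ** matrix_inv A = mat 1 \<and> matrix_inv A ** A = mat 1"
    using assms unfolding invertible_def matrix_inv_def by (rule someI_ex)
  then show "A *v (matrix_inv A *v x) = x" "matrix_inv A *v (A *v x) = x"
    by (simp_all add: matrix_vector_mul_assoc)
qed

text \<open>The vector Z = (D Fhat - I) h solves M Z = G Y with Y = b h_t (f' - c) h taken
  entrywise. The solution bound then gives the factor b K (N_t h_t) g, where N_t h_t is the final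
  time.\<close>

lemma precond_residual_jacobian:
  fixes G L :: "real^'n::finite^'n" and U :: "real^('t::{finite,linorder} \<times> 'n::finite)"
  assumes g: "0 \<le> g" and bh: "0 \<le> b * ht"
    and step: "\<And>z \<zeta> y. z + ((a * ht) *\<^sub>R (G *v (L *v z)) + (b * c * ht) *\<^sub>R (G *v z)) = \<zeta> + G *v y
      \<Longrightarrow> norm z \<le> norm \<zeta> + g * norm y"
    and f': "\<And>x. (f has_real_derivative f' x) (at x)"
    and K: "\<And>x. \<bar>f' x - c\<bar> \<le> K"
    and F: "F = precond_residual a b c f G L ht V"
  shows "(F has_derivative (*v) (jacobian F (at U))) (at U)"
    and "norm (jacobian F (at U) *v h - h) \<le> b * K * (real CARD('t) * ht) * g * norm h"
proof -
  let ?M = "precond a b c G L ht :: real^('t \<times> 'n)^('t \<times> 'n::finite)"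
  let ?E = "\<lambda>h. \<chi> k. (f' (U $ k) - c) * h $ k"
  let ?D = "\<lambda>h. matrix_inv ?M *v (?M *v h + kron (mat 1) G *v ((b * ht) *\<^sub>R ?E h))"
  have inv: "invertible ?M" by (rule invertible_precond[OF g step])
  have D: "(F has_derivative ?D) (at U)"
    unfolding F precond_residual_def
    by (rule bounded_linear.has_derivative[OF matrix_vector_mul_bounded_linear
        residual_has_derivative[OF f']])
  then have diff: "F differentiable (at U)" by (auto simp: differentiable_def)
  then show J: "(F has_derivative (*v) (jacobian F (at U))) (at U)"
    using jacobian_works by blast
  have "jacobian F (at U) *v h = ?D h" using has_derivative_unique[OF J D] by metis
  then have "?M *v (jacobian F (at U) *v h - h) = kron (mat 1) G *v ((b * ht) *\<^sub>R ?E h)"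
    by (simp add: matrix_vector_mult_diff_distrib matrix_inv_cancel[OF inv])
  then have "norm (jacobian F (at U) *v h - h) \<le> g * real CARD('t) * norm ((b * ht) *\<^sub>R ?E h)"
    using precond_solution_bound[OF g step] by blast
  also have "\<dots> \<le> g * real CARD('t) * ((b * ht) * (K * norm h))"
  proof -
    have "0 \<le> K" using K[of 0] by linarith
    then have "norm (?E h) \<le> K * norm h" using K by (intro norm_diagonal_mult_le) auto
    then show ?thesis using g bh by (auto intro!: mult_left_mono)
  qed
  finally show "norm (jacobian F (at U) *v h - h) \<le> b * K * (real CARD('t) * ht) * g * norm h"
    by (simp add: mult_ac)
qed

lemma abs_derivative_le_lipschitz:
  assumes D: "(g has_real_derivative D) (at x)" and C: "C-lipschitz_on UNIV g"
  shows "\<bar>D\<bar> \<le> C"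
proof (rule tendsto_upperbound)
  show "((\<lambda>y. \<bar>(g y - g x) / (y - x)\<bar>) \<longlongrightarrow> \<bar>D\<bar>) (at x)"
    using D by (intro tendsto_rabs) (simp add: has_field_derivative_iff)
  show "\<forall>\<^sub>F y in at x. \<bar>(g y - g x) / (y - x)\<bar> \<le> C"
    unfolding eventually_at_filter
    using lipschitz_onD[OF C, of _ x] by (auto simp: dist_real_def field_simps intro!: always_eventually)
qed simp

text \<open>The Lipschitz condition on \<open>f\<close> makes the set of constants in
  \<open>Lip\<close> nonempty. Every constant in that set bounds the derivative of f(u) - c u, hence
  so does their infimum.\<close>

lemma
  assumes f: "K-lipschitz_on UNIV f"
  shows Lip_minus_linear_nonneg: "0 \<le> Lip (\<lambda>u. f u - c * u)"
    and abs_derivative_diff_le_Lip: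
      "(f has_real_derivative D) (at x) \<Longrightarrow> \<bar>D - c\<bar> \<le> Lip (\<lambda>u. f u - c * u)"
proof -
  have "\<bar>c\<bar>-lipschitz_on UNIV (\<lambda>u. c * u)"
    by (rule lipschitz_onI) (auto simp: dist_real_def abs_mult[symmetric] right_diff_distrib)
  then have "(K + \<bar>c\<bar>)-lipschitz_on UNIV (\<lambda>u. f u - c * u)"
    using f by (intro lipschitz_on_diff)
  then have ne: "{C. C-lipschitz_on UNIV (\<lambda>u. f u - c * u)} \<noteq> {}" by blast
  show "0 \<le> Lip (\<lambda>u. f u - c * u)"
    unfolding Lip_def by (rule cInf_greatest[OF ne]) (auto dest: lipschitz_on_nonneg)
  show "\<bar>D - c\<bar> \<le> Lip (\<lambda>u. f u - c * u)" if D: "(f has_real_derivative D) (at x)"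
  proof -
    have "((\<lambda>u. f u - c * u) has_real_derivative D - c) (at x)"
      by (auto intro!: derivative_eq_intros D)
    then show ?thesis
      unfolding Lip_def using abs_derivative_le_lipschitz by (intro cInf_greatest[OF ne]) blast
  qed
qed

subsection \<open>Decay along the flow\<close>

text \<open>For the energy E = |F(U)|^2 + \<mu> |Q|^2 the chain rule gives E' + 2 r E = -2 times the
  dissipation form. So exp(2 r t) E(t) does not increase, by the mean value theorem with derivatives
  taken within the half-line.\<close>

lemma pdhg_energy_decay:
  fixes F :: "real^'m \<Rightarrow> real^'m"
  assumes flow: "pdhg_flow F \<epsilon> \<gamma> U Q"
    and D: "\<And>U. (F has_derivative (*v) (jacobian F (at U))) (at U)"
    and s: "0 < s" "s \<le> S"
    and lo: "\<And>U x. s * norm x \<le> norm (jacobian F (at U) *v x)"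
    and hi: "\<And>U x. norm (jacobian F (at U) *v x) \<le> S * norm x"
    and \<mu>: "0 \<le> \<mu>" and r: "r \<le> \<epsilon>"
    and A: "\<And>l. l = s\<^sup>2 \<or> l = S\<^sup>2 \<Longrightarrow> r \<le> \<gamma> * l"
    and B: "\<And>l. l = s\<^sup>2 \<or> l = S\<^sup>2 \<Longrightarrow>
      (\<mu> - (1 - \<gamma> * \<epsilon>) * l)\<^sup>2 \<le> 4 * (\<gamma> * l - r) * (\<mu> * (\<epsilon> - r))"
    and t: "0 \<le> t"
  shows "(norm (F (U t)))\<^sup>2 + \<mu> * (norm (Q t))\<^sup>2
    \<le> exp (- 2 * r * t) * ((norm (F (U 0)))\<^sup>2 + \<mu> * (norm (Q 0))\<^sup>2)"
proof -
  define J where "J = (\<lambda>t. jacobian F (at (U t)))"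
  define w where "w = 1 - \<gamma> * \<epsilon>"
  define X where "X = (\<lambda>t. F (U t))"
  define dU where "dU = (\<lambda>t. - (transpose (J t) *v (w *\<^sub>R Q t + \<gamma> *\<^sub>R X t)))"
  define dQ where "dQ = (\<lambda>t. - \<epsilon> *\<^sub>R Q t + X t)"
  define E where "E = (\<lambda>t. X t \<bullet> X t + \<mu> * (Q t \<bullet> Q t))"
  define dE where "dE = (\<lambda>t. 2 * (X t \<bullet> (J t *v dU t)) + \<mu> * (2 * (Q t \<bullet> dQ t)))"
  have dE: "(E has_real_derivative dE t) (at t within {0..})" if "0 \<le> t" for t
  proof -
    have U': "(U has_vector_derivative dU t) (at t within {0..})"
      and Q': "(Q has_vector_derivative dQ t) (at t within {0..})"
      using flow that unfolding pdhg_flow_def dU_def dQ_def J_def w_def X_def by blast+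
    have X': "(X has_vector_derivative J t *v dU t) (at t within {0..})"
      using vector_derivative_diff_chain_within[OF U' has_derivative_at_withinI[OF D]]
      by (simp add: X_def J_def o_def)
    note inner' = bounded_bilinear.has_vector_derivative[OF bounded_bilinear_inner]
    have "((\<lambda>t. X t \<bullet> X t) has_real_derivative 2 * (X t \<bullet> (J t *v dU t))) (at t within {0..})"
      using inner'[OF X' X'] by (simp add: has_real_derivative_iff_has_vector_derivative inner_commute)
    moreover have "((\<lambda>t. Q t \<bullet> Q t) has_real_derivative 2 * (Q t \<bullet> dQ t)) (at t within {0..})"
      using inner'[OF Q' Q'] by (simp add: has_real_derivative_iff_has_vector_derivative inner_commute)
    ultimately show ?thesis
      unfolding E_def dE_def by (intro DERIV_add DERIV_cmult)
  qed
  have dissip: "dE t + 2 * r * E t \<le> 0" for t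
  proof -
    let ?T = "transpose (J t)"
    \<comment> \<open>The operator in the form is J^T, with \<open>u\<close> the residual,
      \<open>v\<close> the dual variable \<open>Q\<close> and
      \<open>D = \<mu> * (\<epsilon> - r)\<close>.\<close>
    have form: "0 \<le> \<gamma> * (norm (?T *v X t))\<^sup>2 - r * (norm (X t))\<^sup>2
        + w * ((?T *v X t) \<bullet> (?T *v Q t)) - \<mu> * (X t \<bullet> Q t) + \<mu> * (\<epsilon> - r) * (norm (Q t))\<^sup>2"
    proof (rule dissipation_form_nonneg)
      show "linear ((*v) ?T)" by (rule matrix_vector_mul_linear)
      show "s * norm x \<le> norm (?T *v x)" for x
        using s(1) lo unfolding J_def by (rule norm_transpose_mult_ge)
      show "norm (?T *v x) \<le> S * norm x" for x
        using hi unfolding J_def by (rule norm_transpose_mult_le)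
    qed (use s \<mu> r A B in \<open>auto simp: w_def\<close>)
    have XJ: "X t \<bullet> (J t *v dU t) = - (w * ((?T *v X t) \<bullet> (?T *v Q t)) + \<gamma> * (norm (?T *v X t))\<^sup>2)"
      unfolding inner_transpose_mult[of "J t" "X t", symmetric] dU_def power2_norm_eq_inner
        matrix_vector_right_distrib matrix_vector_mult_scaleR
      by (simp only: inner_minus_right inner_add_right inner_scaleR_right)
    have QdQ: "Q t \<bullet> dQ t = X t \<bullet> Q t - \<epsilon> * (norm (Q t))\<^sup>2"
      unfolding dQ_def power2_norm_eq_inner
      by (simp add: inner_add_right inner_diff_right inner_commute)
    have ring: "2 * (- (w * XY + \<gamma> * XX)) + \<mu> * (2 * (xq - \<epsilon> * qq)) + 2 * r * (xx + \<mu> * qq)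
        = - 2 * (\<gamma> * XX - r * xx + w * XY - \<mu> * xq + \<mu> * (\<epsilon> - r) * qq)"
      for XX XY xx xq qq :: real by (simp add: algebra_simps)
    show ?thesis
      unfolding dE_def E_def XJ QdQ power2_norm_eq_inner[symmetric] ring
      by (rule mult_nonpos_nonneg[OF _ form]) simp
  qed
  define W where "W = (\<lambda>t. exp (2 * r * t) * E t)"
  have W': "(W has_real_derivative exp (2 * r * t) * (dE t + 2 * r * E t)) (at t within {0..})"
    if "0 \<le> t" for t
    unfolding W_def by (rule derivative_eq_intros dE[OF that] refl)+ (simp add: algebra_simps)
  have "W t \<le> W 0"
  proof (cases "t = 0")
    case False
    then have "0 < t" using t by simp
    have "(W has_derivative (*) (exp (2 * r * x) * (dE x + 2 * r * E x))) (at x within {0..t})"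
      if "0 \<le> x" "x \<le> t" for x
      using W'[OF that(1)] unfolding has_field_derivative_def
      by (rule has_derivative_subset) auto
    from mvt_simple[OF \<open>0 < t\<close> this] obtain x where
      "W t - W 0 = exp (2 * r * x) * (dE x + 2 * r * E x) * (t - 0)" by fastforce
    also have "\<dots> \<le> 0"
      using dissip[of x] t by (simp add: mult_le_0_iff)
    finally show ?thesis by simp
  qed simp
  then have "exp (- 2 * r * t) * W t \<le> exp (- 2 * r * t) * W 0"
    by (intro mult_left_mono) auto
  moreover have "exp (- 2 * r * t) * W t = E t"
    by (simp add: W_def mult.assoc[symmetric] flip: exp_add)
  moreover have "W 0 = E 0" by (simp add: W_def)
  ultimately have "E t \<le> exp (- 2 * r * t) * E 0" by (simp only:)
  then show ?thesis unfolding E_def X_def power2_norm_eq_inner .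
qed

lemma singular_values_near_identity:
  assumes "\<And>h. norm (A *v h - h) \<le> \<theta> * norm h" and "\<sigma> \<in> singular_values A"
  shows "1 - \<theta> \<le> \<sigma>" "\<sigma> \<le> 1 + \<theta>"
proof -
  obtain v where v: "norm v = 1" "norm (A *v v) = \<sigma>" using assms(2) by (rule singular_value_norm)
  have "\<bar>norm (A *v v) - norm v\<bar> \<le> \<theta>"
    using norm_triangle_ineq3[of "A *v v" v] assms(1)[of v] v(1) by simp
  then show "1 - \<theta> \<le> \<sigma>" "\<sigma> \<le> 1 + \<theta>" using v by auto
qed

lemma pdhg_near_identity_decay:
  fixes F :: "real^'m \<Rightarrow> real^'m"
  assumes \<theta>: "0 \<le> \<theta>" "\<theta> < 1"
    and D: "\<And>U. (F has_derivative (*v) (jacobian F (at U))) (at U)"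
    and near: "\<And>U h. norm (jacobian F (at U) *v h - h) \<le> \<theta> * norm h"
    and slo: "s = (INF U. sigma_min (jacobian F (at U)))"
    and shi: "S = (SUP U. sigma_max (jacobian F (at U)))"
    and \<kappa>: "\<kappa> = S / s" and \<epsilon>: "\<epsilon> = \<kappa> - 1 / 2" and \<gamma>: "\<gamma> = 1 / \<kappa> - 1 / (2 * \<kappa>\<^sup>2)"
    and flow: "pdhg_flow F \<epsilon> \<gamma> U Q" and t: "0 \<le> t"
  shows "norm (F (U t)) \<le> exp (- (5 / 32) * ((1 - \<theta>) ^ 3 / (1 + \<theta>)) * t)
    * sqrt ((norm (F (U 0)))\<^sup>2 + (1 + \<theta>) * (norm (Q 0))\<^sup>2)"
proof -
  let ?J = "\<lambda>U. jacobian F (at U)"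
  have min: "1 - \<theta> \<le> sigma_min (?J U)" and max: "sigma_max (?J U) \<le> 1 + \<theta>" for U
    using singular_values_near_identity[OF near] sigma_min_in sigma_max_in by blast+
  \<comment> \<open>The uniform bounds \<open>1 - \<theta>\<close> and \<open>1 + \<theta>\<close>
    make both families bounded, so that the infimum and supremum over the reals are genuine.\<close>
  have lo: "s \<le> sigma_min (?J U)" for U
    unfolding slo using min by (intro cINF_lower bdd_belowI2) auto
  have hi: "sigma_max (?J U) \<le> S" for U
    unfolding shi using max by (intro cSUP_upper bdd_aboveI2) auto
  have s1: "1 - \<theta> \<le> s" unfolding slo using min by (intro cINF_greatest) auto
  have S1: "S \<le> 1 + \<theta>" unfolding shi using max by (intro cSUP_least) auto
  have "sigma_min (?J 0) \<le> sigma_max (?J 0)"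
    unfolding sigma_min_def by (rule Min_le[OF finite_singular_values sigma_max_in])
  then have sS: "s \<le> S" using lo[of 0] hi[of 0] by linarith
  define r where "r = 5 / 32 * ((1 - \<theta>) ^ 3 / (1 + \<theta>))"
  define \<mu> where "\<mu> = min (s\<^sup>2) (1 + \<theta>)"
  note coeff = decay_coefficients[OF \<theta> s1 sS S1 \<kappa> \<epsilon> \<gamma> r_def \<mu>_def]
  have \<mu>: "0 \<le> \<mu>" "\<mu> \<le> 1 + \<theta>" using \<theta> by (auto simp: \<mu>_def)
  have "(norm (F (U t)))\<^sup>2 \<le> (norm (F (U t)))\<^sup>2 + \<mu> * (norm (Q t))\<^sup>2" using \<mu> by simp
  also have "\<dots> \<le> exp (- 2 * r * t) * ((norm (F (U 0)))\<^sup>2 + \<mu> * (norm (Q 0))\<^sup>2)"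
  proof (rule pdhg_energy_decay[OF flow D _ sS])
    show "s * norm x \<le> norm (?J U *v x)" for U x
      using mult_right_mono[OF lo norm_ge_zero] sigma_min_le by (rule order_trans)
    show "norm (?J U *v x) \<le> S * norm x" for U x
      using sigma_max_ge mult_right_mono[OF hi norm_ge_zero] by (rule order_trans)
  qed (use \<theta> s1 \<mu> t coeff in auto)
  also have "\<dots> \<le> exp (- 2 * r * t) * ((norm (F (U 0)))\<^sup>2 + (1 + \<theta>) * (norm (Q 0))\<^sup>2)"
    using \<mu> by (intro mult_left_mono add_left_mono mult_right_mono) auto
  also have "exp (- 2 * r * t) = (exp (- r * t))\<^sup>2"
    by (simp add: power2_eq_square flip: exp_add)
  finally have "sqrt ((norm (F (U t)))\<^sup>2)
      \<le> sqrt ((exp (- r * t))\<^sup>2 * ((norm (F (U 0)))\<^sup>2 + (1 + \<theta>) * (norm (Q 0))\<^sup>2))"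
    by (rule real_sqrt_le_mono)
  then show ?thesis by (simp add: real_sqrt_mult r_def)
qed

theorem corollary7p1:
  fixes a b c ht T \<theta> \<sigma>lo \<sigma>hi \<kappa> \<epsilon> \<gamma> :: real
    and f :: "real \<Rightarrow> real"
    and G L :: "real^('x::finite \<times> 'x)^('x \<times> 'x)"
    and V :: "real^('t::{finite,linorder} \<times> ('x \<times> 'x))"
    and Fhat :: "real^('t \<times> ('x \<times> 'x)) \<Rightarrow> real^('t \<times> ('x \<times> 'x))"
  assumes "a \<ge> 0" and "b \<ge> 0" and "c \<ge> 0"
    and "f C1_differentiable_on UNIV" and "\<exists>K. K-lipschitz_on UNIV f"
    and "self_adjoint G" and "nonneg_definite G"
    and "self_adjoint L" and "nonneg_definite L"
    and "G ** L = L ** G"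
    and "ht > 0" and "T = real CARD('t) * ht"
    and "(G = mat 1 \<and> b * Lip (\<lambda>u. f u - c * u) * T < 1
            \<and> \<theta> = b * Lip (\<lambda>u. f u - c * u) * T)
         \<or> (G = L \<and> b * Lip (\<lambda>u. f u - c * u) * T < 2 * sqrt (a * ht) + b * c * ht
            \<and> \<theta> = b * Lip (\<lambda>u. f u - c * u) * T / (2 * sqrt (a * ht) + b * c * ht))"
    and "Fhat = precond_residual a b c f G L ht V"
    and "\<sigma>lo = (INF U. sigma_min (jacobian Fhat (at U)))"
    and "\<sigma>hi = (SUP U. sigma_max (jacobian Fhat (at U)))"
    and "\<kappa> = \<sigma>hi / \<sigma>lo"
    and "\<epsilon> = \<kappa> - 1 / 2"
    and "\<gamma> = 1 / \<kappa> - 1 / (2 * \<kappa>\<^sup>2)"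
  shows "\<theta> < 1 \<and>
    (\<forall>U Q. pdhg_flow Fhat \<epsilon> \<gamma> U Q \<longrightarrow>
      (\<forall>t\<ge>0. norm (Fhat (U t))
         \<le> exp (- (5 / 32) * ((1 - \<theta>) ^ 3 / (1 + \<theta>)) * t)
           * sqrt ((norm (Fhat (U 0)))\<^sup>2 + (1 + \<theta>) * (norm (Q 0))\<^sup>2)))"
proof -
  let ?Lip = "Lip (\<lambda>u. f u - c * u)"
  obtain K where K: "K-lipschitz_on UNIV f" using assms(5) by blast
  obtain f' where f': "\<And>x. (f has_real_derivative f' x) (at x)"
    using assms(4) unfolding C1_differentiable_on_def has_real_derivative_iff_has_vector_derivative by auto
  have Lip0: "0 \<le> ?Lip" using K by (rule Lip_minus_linear_nonneg)
  have T0: "0 < T" using assms(11,12) by simp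
  have nn: "0 \<le> x \<bullet> (L *v x)" for x using assms(9) by (simp add: nonneg_definite_def)
  have sym: "(L *v x) \<bullet> y = x \<bullet> (L *v y)" for x y
    using inner_transpose_mult[of L x y] assms(8) unfolding self_adjoint_def by metis
  \<comment> \<open>Both alternatives enter the rest of the proof only through the gain
    \<open>g\<close> of one implicit step: 1 in the Allen-Cahn case and \<open>1 / ?d\<close> in the
    Cahn-Hilliard case.\<close>
  obtain g where g: "0 \<le> g" and \<theta>: "\<theta> = b * ?Lip * T * g" and "\<theta> < 1"
    and step: "\<And>z \<zeta> y. z + ((a * ht) *\<^sub>R (G *v (L *v z)) + (b * c * ht) *\<^sub>R (G *v z)) = \<zeta> + G *v y
      \<Longrightarrow> norm z \<le> norm \<zeta> + g * norm y"
    using assms(13)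
  proof (elim disjE conjE)
    assume G: "G = mat 1" and "b * ?Lip * T < 1" "\<theta> = b * ?Lip * T"
    show thesis
    proof (rule that[of 1])
      fix z \<zeta> y
      assume z: "z + ((a * ht) *\<^sub>R (G *v (L *v z)) + (b * c * ht) *\<^sub>R (G *v z)) = \<zeta> + G *v y"
      \<comment> \<open>The implicit terms have a nonnegative inner product with \<open>z\<close>,
        so \<open>z\<close> is no longer than the right-hand side of its step.\<close>
      have "0 \<le> z \<bullet> ((a * ht) *\<^sub>R (L *v z) + (b * c * ht) *\<^sub>R z)"
        using nn[of z] assms(1-3,11) by (simp add: inner_add_right)
      then have "norm z \<le> norm (\<zeta> + y)"
        using norm_le_norm_add_nonneg z by (fastforce simp: G)
      then show "norm z \<le> norm \<zeta> + 1 * norm y" using norm_triangle_ineq[of \<zeta> y] by simp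
    qed (use \<open>b * ?Lip * T < 1\<close> \<open>\<theta> = b * ?Lip * T\<close> in auto)
  next
    let ?d = "2 * sqrt (a * ht) + b * c * ht"
    assume G: "G = L" and lt: "b * ?Lip * T < ?d" and \<theta>: "\<theta> = b * ?Lip * T / ?d"
    \<comment> \<open>Together with the strict inequality this forces the denominator to be
      positive, which rules out a degenerate division by zero.\<close>
    have "0 \<le> b * ?Lip * T" using assms(2) Lip0 T0 by simp
    then have d: "0 < ?d" using lt by linarith
    show thesis
    proof (rule that[of "1 / ?d"])
      fix z \<zeta> y
      assume "z + ((a * ht) *\<^sub>R (G *v (L *v z)) + (b * c * ht) *\<^sub>R (G *v z)) = \<zeta> + G *v y"
      then show "norm z \<le> norm \<zeta> + 1 / ?d * norm y"
        unfolding G using sym nn d assms(1-3,11)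
        by (intro implicit_step_bound[where L = "(*v) L"]) auto
    qed (use d lt \<theta> in auto)
  qed
  have bh: "0 \<le> b * ht" using assms(2,11) by simp
  note jac = precond_residual_jacobian[OF g bh step f' abs_derivative_diff_le_Lip[OF K f'] assms(14)]
  have near: "norm (jacobian Fhat (at U) *v h - h) \<le> \<theta> * norm h" for U h
    using jac(2)[of U h] by (simp add: \<theta> assms(12))
  have \<theta>0: "0 \<le> \<theta>" using assms(2) Lip0 T0 g by (simp add: \<theta>)
  show ?thesis
    using \<open>\<theta> < 1\<close> pdhg_near_identity_decay[OF \<theta>0 \<open>\<theta> < 1\<close> jac(1) near assms(15-19)] by blast
qed

end
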